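(* Let $X$ be a complex affine variety endowed with an effective action $\mu:\mathbb{G}_m\times X\to X$ of the multiplicative group, let $f\in\mathcal{O}(X)$ be a semi-invariant of weight $m\neq 0$, and let $\ell,\ell'\geq 1$ be integers. Then the following hold: (1) If $\ell'$ is congruent to $\ell$ or $-\ell$ modulo $m$, then the fibrations $\rho_{f,\ell}:\widetilde{X}_{f,\ell}\to\mathbb{G}_m$ and $\rho_{f,\ell'}:\widetilde{X}_{f,\ell'}\to\mathbb{G}_m$ are isomorphic up to an automorphism of $\mathbb{G}_m$, i.e. there exist an isomorphism $\Phi:\widetilde{X}_{f,\ell}\to\widetilde{X}_{f,\ell'}$ and an automorphism $\varphi$ of the variety $\mathbb{G}_m$ such that $\rho_{f,\ell'}\circ\Phi=\varphi\circ\rho_{f,\ell}$. (2) If the residue classes modulo $m$ of $\ell$ and $\ell'$ generate the same subgroup of $\mathbb{Z}_m=\mathbb{Z}/m\mathbb{Z}$, i.e. if $\gcd(\ell,m)=\gcd(\ell',m)$, then $\widetilde{X}_{f,\ell}\times\mathbb{A}^1_*$ and $\widetilde{X}_{f,\ell'}\times\mathbb{A}^1_*$ are isomorphic as abstract algebraic varieties.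
   Context: All varieties are over $\mathbb{C}$; $\mathbb{G}_m=\mathrm{Spec}(\mathbb{C}[t^{\pm1}])$ is the multiplicative group and $\mathbb{A}^1_*=\mathbb{A}^1\setminus\{0\}$. A regular function $f\in\mathcal{O}(X)$ is a semi-invariant of weight $m\in\mathbb{Z}$ if $f(\mu(t,x))=t^m f(x)$ for all $x\in X$ (and all $t\in\mathbb{G}_m$). For $\ell\geq1$, $\widetilde{X}_{f,\ell}$ is the closed subvariety of $X\times\mathbb{G}_m=\mathrm{Spec}(\mathcal{O}(X)[t^{\pm1}])$ defined by the equation $t^{\ell}f=1$, and $\rho_{f,\ell}:\widetilde{X}_{f,\ell}\to\mathbb{G}_m$ is the restriction of the second projection $(x,t)\mapsto t$. *)

theory Defs
  imports Complex_Main "HOL-Library.FuncSet" "HOL-Number_Theory.Cong"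
begin

text \<open>
  A (reduced) complex affine variety is represented intrinsically by its set of closed points
  together with its algebra of regular functions, an honest algebra of complex-valued functions
  on that set; functions on a set \<open>P\<close> are taken extensional (\<open>undefined\<close> outside \<open>P\<close>), so that
  each function has exactly one representative. Varieties need not be irreducible.
\<close>

record 'a variety =
  pts :: "'a set"
  reg :: "('a \<Rightarrow> complex) set"

inductive_set generated_algebra :: "'a set \<Rightarrow> ('a \<Rightarrow> complex) set \<Rightarrow> ('a \<Rightarrow> complex) set"
  for P :: "'a set" and S :: "('a \<Rightarrow> complex) set" where
  gen: "f \<in> S \<Longrightarrow> restrict f P \<in> generated_algebra P S"
| const: "(\<lambda>x\<in>P. c) \<in> generated_algebra P S"
| add: "f \<in> generated_algebra P S \<Longrightarrow> g \<in> generated_algebra P S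
    \<Longrightarrow> (\<lambda>x\<in>P. f x + g x) \<in> generated_algebra P S"
| mult: "f \<in> generated_algebra P S \<Longrightarrow> g \<in> generated_algebra P S
    \<Longrightarrow> (\<lambda>x\<in>P. f x * g x) \<in> generated_algebra P S"

definition character :: "'a variety \<Rightarrow> (('a \<Rightarrow> complex) \<Rightarrow> complex) \<Rightarrow> bool" where
  "character X \<chi> \<longleftrightarrow>
     (\<forall>c. \<chi> (\<lambda>x\<in>pts X. c) = c) \<and>
     (\<forall>f\<in>reg X. \<forall>g\<in>reg X. \<chi> (\<lambda>x\<in>pts X. f x + g x) = \<chi> f + \<chi> g) \<and>
     (\<forall>f\<in>reg X. \<forall>g\<in>reg X. \<chi> (\<lambda>x\<in>pts X. f x * g x) = \<chi> f * \<chi> g)"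

text \<open>
  The algebra of regular functions is finitely generated, and evaluation identifies the points
  with its \<open>\<complex>\<close>-algebra homomorphisms to \<open>\<complex>\<close>. By the Nullstellensatz these are the closed points
  of its spectrum; equivalently, a choice of generators embeds the points as a Zariski closed
  subset of some affine space, on which the regular functions are the restrictions of polynomials.
\<close>

definition affine_variety :: "'a variety \<Rightarrow> bool" where
  "affine_variety X \<longleftrightarrow>
     (\<exists>S. finite S \<and> reg X = generated_algebra (pts X) S) \<and>
     (\<forall>x\<in>pts X. \<forall>y\<in>pts X. (\<forall>f\<in>reg X. f x = f y) \<longrightarrow> x = y) \<and>
     (\<forall>\<chi>. character X \<chi> \<longrightarrow> (\<exists>x\<in>pts X. \<forall>f\<in>reg X. \<chi> f = f x))"

definition morphism :: "'a variety \<Rightarrow> 'b variety \<Rightarrow> ('a \<Rightarrow> 'b) \<Rightarrow> bool" where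
  "morphism X Y \<phi> \<longleftrightarrow>
     \<phi> \<in> pts X \<rightarrow> pts Y \<and> (\<forall>g\<in>reg Y. (\<lambda>x\<in>pts X. g (\<phi> x)) \<in> reg X)"

definition isomorphism :: "'a variety \<Rightarrow> 'b variety \<Rightarrow> ('a \<Rightarrow> 'b) \<Rightarrow> bool" where
  "isomorphism X Y \<phi> \<longleftrightarrow> morphism X Y \<phi> \<and>
     (\<exists>\<psi>. morphism Y X \<psi> \<and> (\<forall>x\<in>pts X. \<psi> (\<phi> x) = x) \<and> (\<forall>y\<in>pts Y. \<phi> (\<psi> y) = y))"

definition isomorphic :: "'a variety \<Rightarrow> 'b variety \<Rightarrow> bool" where
  "isomorphic X Y \<longleftrightarrow> (\<exists>\<phi>. isomorphism X Y \<phi>)"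

abbreviation automorphism :: "'a variety \<Rightarrow> ('a \<Rightarrow> 'a) \<Rightarrow> bool" where
  "automorphism X \<equiv> isomorphism X X"

text \<open>The regular functions on a product are the sums of products \<open>f(x) g(y)\<close>, i.e. the image of
  the tensor product of the two coordinate algebras.\<close>

definition prod_variety :: "'a variety \<Rightarrow> 'b variety \<Rightarrow> ('a \<times> 'b) variety"
    (infixr "\<times>\<^sub>v" 80) where
  "X \<times>\<^sub>v Y =
     \<lparr>pts = pts X \<times> pts Y,
      reg = generated_algebra (pts X \<times> pts Y)
              ((\<lambda>f. f \<circ> fst) ` reg X \<union> (\<lambda>g. g \<circ> snd) ` reg Y)\<rparr>"

text \<open>To be used for Zariski closed \<open>Z \<subseteq> pts X\<close> only.\<close>

definition closed_subvariety :: "'a variety \<Rightarrow> 'a set \<Rightarrow> 'a variety" where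
  "closed_subvariety X Z = \<lparr>pts = Z, reg = (\<lambda>f. restrict f Z) ` reg X\<rparr>"

definition principal_open :: "'a variety \<Rightarrow> ('a \<Rightarrow> complex) \<Rightarrow> 'a variety" where
  "principal_open X f =
     \<lparr>pts = {x \<in> pts X. f x \<noteq> 0},
      reg = generated_algebra {x \<in> pts X. f x \<noteq> 0} (reg X \<union> {\<lambda>x. inverse (f x)})\<rparr>"

definition A1 :: "complex variety" where
  "A1 = \<lparr>pts = UNIV, reg = generated_algebra UNIV {\<lambda>z. z}\<rparr>"

definition A1_star :: "complex variety" where
  "A1_star = principal_open A1 (\<lambda>z. z)"

definition Gm :: "complex variety" where
  "Gm = \<lparr>pts = - {0}, reg = generated_algebra (- {0}) {\<lambda>t. t, \<lambda>t. inverse t}\<rparr>"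

definition Gm_action :: "'a variety \<Rightarrow> (complex \<times> 'a \<Rightarrow> 'a) \<Rightarrow> bool" where
  "Gm_action X \<mu> \<longleftrightarrow>
     morphism (Gm \<times>\<^sub>v X) X \<mu> \<and>
     (\<forall>x\<in>pts X. \<mu> (1, x) = x) \<and>
     (\<forall>s\<in>pts Gm. \<forall>t\<in>pts Gm. \<forall>x\<in>pts X. \<mu> (s, \<mu> (t, x)) = \<mu> (s * t, x))"

definition effective :: "'a variety \<Rightarrow> (complex \<times> 'a \<Rightarrow> 'a) \<Rightarrow> bool" where
  "effective X \<mu> \<longleftrightarrow> (\<forall>t\<in>pts Gm. (\<forall>x\<in>pts X. \<mu> (t, x) = x) \<longrightarrow> t = 1)"

definition semi_invariant ::
    "'a variety \<Rightarrow> (complex \<times> 'a \<Rightarrow> 'a) \<Rightarrow> ('a \<Rightarrow> complex) \<Rightarrow> int \<Rightarrow> bool" where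
  "semi_invariant X \<mu> f m \<longleftrightarrow>
     f \<in> reg X \<and> (\<forall>t\<in>pts Gm. \<forall>x\<in>pts X. f (\<mu> (t, x)) = t powi m * f x)"

text \<open>For \<open>l \<ge> 1\<close> the equation \<open>t^l f = 1\<close> defines a reduced subscheme of \<open>X \<times> G\<^sub>m\<close>, since it is
  etale over the locus where \<open>f\<close> does not vanish; so its coordinate algebra is indeed an algebra of
  functions on its set of points.\<close>

definition X_tilde :: "'a variety \<Rightarrow> ('a \<Rightarrow> complex) \<Rightarrow> nat \<Rightarrow> ('a \<times> complex) variety" where
  "X_tilde X f l = closed_subvariety (X \<times>\<^sub>v Gm) {(x, t) \<in> pts (X \<times>\<^sub>v Gm). t ^ l * f x = 1}"

definition rho :: "'a variety \<Rightarrow> ('a \<Rightarrow> complex) \<Rightarrow> nat \<Rightarrow> 'a \<times> complex \<Rightarrow> complex" where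
  "rho X f l = restrict snd (pts (X_tilde X f l))"

end

theory Submission
  imports Defs
begin

text \<open>
  The action lets powers of \<open>t\<close> be traded against moving the point: since \<open>f\<close> has weight \<open>m\<close>,
  replacing \<open>x\<close> by \<open>\<mu> (t powi k, x)\<close> multiplies \<open>f x\<close> by \<open>t powi (k * m)\<close>. So the equation
  \<open>t ^ l * f x = 1\<close> depends on \<open>l\<close> only modulo \<open>m\<close>, and inverting \<open>t\<close> changes the sign of \<open>l\<close>.
  This is the first claim.

  For the second claim, the extra factor enlarges the parameter space to the torus of pairs
  \<open>(t, s)\<close>, whose monomial automorphisms form \<open>GL\<^sub>2(\<int>)\<close>. The fibrations are given by the
  characters \<open>(l, 0)\<close> and \<open>(l', 0)\<close>, which again matter only modulo \<open>m\<close>, and a unimodular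
  matrix with first row \<open>(c, d)\<close> carries \<open>(l', 0)\<close> to \<open>(c * l', d * l')\<close>. With
  \<open>g = gcd l m = gcd l' m\<close> the choice \<open>d = m / g\<close> makes the second entry divisible by \<open>m\<close>,
  and \<open>c * l'\<close> can be made congruent to \<open>l\<close> by some \<open>c\<close> that is prime to \<open>d\<close>, because \<open>l / g\<close> and
  \<open>l' / g\<close> are units modulo \<open>m / g\<close>; this is \<open>unimodular_weights\<close>.

  Both claims are instances of \<open>twist_isomorphism\<close>, which compares the families
  \<open>{(x, t). \<chi> t * f x = 1}\<close> over an arbitrary parameter variety. That the explicit maps and their
  inverses are morphisms follows by composing projections, pairings and monomials.
\<close>

section \<open>Regular functions and morphisms\<close>

text \<open>Closure under the operations, without naming generators, is the form of the algebra axioms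
  that passes to closed subvarieties by restriction.\<close>

definition function_algebra :: "'a variety \<Rightarrow> bool" where
  "function_algebra V \<longleftrightarrow>
     (\<forall>c. (\<lambda>x\<in>pts V. c) \<in> reg V) \<and>
     (\<forall>f\<in>reg V. \<forall>g\<in>reg V. (\<lambda>x\<in>pts V. f x + g x) \<in> reg V) \<and>
     (\<forall>f\<in>reg V. \<forall>g\<in>reg V. (\<lambda>x\<in>pts V. f x * g x) \<in> reg V)"

lemma generated_algebra_subset:
  assumes "\<And>f. f \<in> S \<Longrightarrow> restrict f P \<in> generated_algebra P R"
  shows "generated_algebra P S \<subseteq> generated_algebra P R"
proof
  show "f \<in> generated_algebra P R" if "f \<in> generated_algebra P S" for f
    using that by induction (blast intro: assms generated_algebra.intros)+
qed

lemma function_algebra_generated: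
  "reg V = generated_algebra (pts V) S \<Longrightarrow> function_algebra V"
  by (auto simp: function_algebra_def intro: generated_algebra.intros)

lemma function_algebra_prod [simp]: "function_algebra (X \<times>\<^sub>v Y)"
  by (rule function_algebra_generated) (simp add: prod_variety_def)

lemma function_algebra_Gm [simp]: "function_algebra Gm"
  by (rule function_algebra_generated) (simp add: Gm_def)

lemma function_algebra_closed_subvariety:
  assumes "function_algebra X" and "Z \<subseteq> pts X"
  shows "function_algebra (closed_subvariety X Z)"
proof -
  have const: "(\<lambda>x\<in>Z. c) \<in> (\<lambda>f. restrict f Z) ` reg X" for c
    by (rule image_eqI[where x = "\<lambda>x\<in>pts X. c"])
      (use assms in \<open>auto simp: function_algebra_def restrict_def fun_eq_iff\<close>)
  have add: "(\<lambda>x\<in>Z. restrict f Z x + restrict g Z x) \<in> (\<lambda>f. restrict f Z) ` reg X"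
    if "f \<in> reg X" "g \<in> reg X" for f g
    by (rule image_eqI[where x = "\<lambda>x\<in>pts X. f x + g x"])
      (use assms that in \<open>auto simp: function_algebra_def restrict_def fun_eq_iff\<close>)
  have mult: "(\<lambda>x\<in>Z. restrict f Z x * restrict g Z x) \<in> (\<lambda>f. restrict f Z) ` reg X"
    if "f \<in> reg X" "g \<in> reg X" for f g
    by (rule image_eqI[where x = "\<lambda>x\<in>pts X. f x * g x"])
      (use assms that in \<open>auto simp: function_algebra_def restrict_def fun_eq_iff\<close>)
  show ?thesis
    using const add mult unfolding function_algebra_def closed_subvariety_def by auto
qed

text \<open>Pulling back along \<open>\<phi>\<close> respects constants, sums and products, so regularity of a pullback
  propagates from generators to the whole coordinate algebra.\<close>

lemma morphism_generatedI:
  assumes "reg Y = generated_algebra (pts Y) S" and "function_algebra X"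
    and maps: "\<phi> \<in> pts X \<rightarrow> pts Y"
    and gens: "\<And>g. g \<in> S \<Longrightarrow> (\<lambda>x\<in>pts X. g (\<phi> x)) \<in> reg X"
  shows "morphism X Y \<phi>"
proof -
  have "(\<lambda>x\<in>pts X. g (\<phi> x)) \<in> reg X" if "g \<in> generated_algebra (pts Y) S" for g
    using that
  proof induction
    case (gen f)
    have "(\<lambda>x\<in>pts X. restrict f (pts Y) (\<phi> x)) = (\<lambda>x\<in>pts X. f (\<phi> x))"
      using maps by (auto simp: fun_eq_iff restrict_def)
    then show ?case using gens[OF gen] by (simp only:)
  next
    case (const c)
    have "(\<lambda>x\<in>pts X. (\<lambda>y\<in>pts Y. c) (\<phi> x)) = (\<lambda>x\<in>pts X. c)"
      using maps by (auto simp: fun_eq_iff restrict_def)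
    then show ?case using assms(2) unfolding function_algebra_def by metis
  next
    case (add f g)
    have "(\<lambda>x\<in>pts X. (\<lambda>y\<in>pts Y. f y + g y) (\<phi> x)) =
        (\<lambda>x\<in>pts X. (\<lambda>x\<in>pts X. f (\<phi> x)) x + (\<lambda>x\<in>pts X. g (\<phi> x)) x)"
      using maps by (auto simp: fun_eq_iff restrict_def)
    then show ?case using assms(2) add.IH unfolding function_algebra_def by metis
  next
    case (mult f g)
    have "(\<lambda>x\<in>pts X. (\<lambda>y\<in>pts Y. f y * g y) (\<phi> x)) =
        (\<lambda>x\<in>pts X. (\<lambda>x\<in>pts X. f (\<phi> x)) x * (\<lambda>x\<in>pts X. g (\<phi> x)) x)"
      using maps by (auto simp: fun_eq_iff restrict_def)
    then show ?case using assms(2) mult.IH unfolding function_algebra_def by metis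
  qed
  then show ?thesis using assms(1) maps by (auto simp: morphism_def)
qed

lemma morphism_maps: "morphism X Y \<phi> \<Longrightarrow> x \<in> pts X \<Longrightarrow> \<phi> x \<in> pts Y"
  by (auto simp: morphism_def)

lemma morphism_pullback: "morphism X Y \<phi> \<Longrightarrow> g \<in> reg Y \<Longrightarrow> (\<lambda>x\<in>pts X. g (\<phi> x)) \<in> reg X"
  by (auto simp: morphism_def)

lemma morphism_comp:
  assumes "morphism X Y \<phi>" and "morphism Y Z \<psi>"
  shows "morphism X Z (\<lambda>x. \<psi> (\<phi> x))"
proof -
  have "(\<lambda>x\<in>pts X. g (\<psi> (\<phi> x))) \<in> reg X" if "g \<in> reg Z" for g
  proof -
    have "(\<lambda>x\<in>pts X. (\<lambda>y\<in>pts Y. g (\<psi> y)) (\<phi> x)) = (\<lambda>x\<in>pts X. g (\<psi> (\<phi> x)))"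
      using morphism_maps[OF assms(1)] by (auto simp: fun_eq_iff restrict_def)
    then show ?thesis
      using morphism_pullback[OF assms(1) morphism_pullback[OF assms(2) that]] by simp
  qed
  then show ?thesis
    using assms morphism_maps by (fastforce simp: morphism_def)
qed

lemma isomorphismI:
  assumes "morphism X Y \<phi>" and "morphism Y X \<psi>"
    and "\<And>x. x \<in> pts X \<Longrightarrow> \<psi> (\<phi> x) = x" and "\<And>y. y \<in> pts Y \<Longrightarrow> \<phi> (\<psi> y) = y"
  shows "isomorphism X Y \<phi>"
  using assms unfolding isomorphism_def by blast

lemma isomorphic_sym: "isomorphic X Y \<Longrightarrow> isomorphic Y X"
  unfolding isomorphic_def isomorphism_def by blast

lemma isomorphic_trans:
  assumes "isomorphic X Y" and "isomorphic Y Z"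
  shows "isomorphic X Z"
proof -
  obtain \<phi> \<phi>' where \<phi>: "morphism X Y \<phi>" "morphism Y X \<phi>'"
      "\<forall>x\<in>pts X. \<phi>' (\<phi> x) = x" "\<forall>y\<in>pts Y. \<phi> (\<phi>' y) = y"
    using assms(1) unfolding isomorphic_def isomorphism_def by blast
  obtain \<psi> \<psi>' where \<psi>: "morphism Y Z \<psi>" "morphism Z Y \<psi>'"
      "\<forall>x\<in>pts Y. \<psi>' (\<psi> x) = x" "\<forall>y\<in>pts Z. \<psi> (\<psi>' y) = y"
    using assms(2) unfolding isomorphic_def isomorphism_def by blast
  have "isomorphism X Z (\<lambda>x. \<psi> (\<phi> x))"
    by (rule isomorphismI[OF morphism_comp[OF \<phi>(1) \<psi>(1)] morphism_comp[OF \<psi>(2) \<phi>(2)]])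
      (use \<phi> \<psi> morphism_maps in \<open>metis+\<close>)
  then show ?thesis unfolding isomorphic_def by blast
qed

section \<open>Products and closed subvarieties\<close>

lemma pts_prod [simp]: "pts (X \<times>\<^sub>v Y) = pts X \<times> pts Y"
  by (simp add: prod_variety_def)

lemma pts_closed_subvariety [simp]: "pts (closed_subvariety X Z) = Z"
  by (simp add: closed_subvariety_def)

lemma morphism_fst: "morphism (X \<times>\<^sub>v Y) X fst"
proof -
  have "(\<lambda>p\<in>pts X \<times> pts Y. g (fst p)) \<in> reg (X \<times>\<^sub>v Y)" if "g \<in> reg X" for g
    using generated_algebra.gen[of "g \<circ> fst" _ "pts X \<times> pts Y"] that
    by (simp add: prod_variety_def comp_def)
  then show ?thesis by (auto simp: morphism_def)
qed

lemma morphism_snd: "morphism (X \<times>\<^sub>v Y) Y snd"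
proof -
  have "(\<lambda>p\<in>pts X \<times> pts Y. g (snd p)) \<in> reg (X \<times>\<^sub>v Y)" if "g \<in> reg Y" for g
    using generated_algebra.gen[of "g \<circ> snd" _ "pts X \<times> pts Y"] that
    by (simp add: prod_variety_def comp_def)
  then show ?thesis by (auto simp: morphism_def)
qed

lemma morphism_Pair:
  assumes "function_algebra V" and "morphism V X \<phi>" and "morphism V Y \<psi>"
  shows "morphism V (X \<times>\<^sub>v Y) (\<lambda>v. (\<phi> v, \<psi> v))"
proof (rule morphism_generatedI)
  show "reg (X \<times>\<^sub>v Y) = generated_algebra (pts (X \<times>\<^sub>v Y))
      ((\<lambda>f. f \<circ> fst) ` reg X \<union> (\<lambda>g. g \<circ> snd) ` reg Y)"
    by (simp add: prod_variety_def)
qed (use assms in \<open>auto simp: morphism_def\<close>)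

lemma morphism_inclusion:
  assumes "Z \<subseteq> pts X"
  shows "morphism (closed_subvariety X Z) X (\<lambda>x. x)"
  using assms by (auto simp: morphism_def closed_subvariety_def)

lemma morphism_into_closed_subvariety:
  assumes "morphism V X \<phi>" and "\<And>v. v \<in> pts V \<Longrightarrow> \<phi> v \<in> Z"
  shows "morphism V (closed_subvariety X Z) \<phi>"
proof -
  have "(\<lambda>v\<in>pts V. restrict g Z (\<phi> v)) \<in> reg V" if "g \<in> reg X" for g
  proof -
    have "(\<lambda>v\<in>pts V. restrict g Z (\<phi> v)) = (\<lambda>v\<in>pts V. g (\<phi> v))"
      using assms(2) by (auto simp: fun_eq_iff restrict_def)
    then show ?thesis using morphism_pullback[OF assms(1) that] by simp
  qed
  then show ?thesis using assms(2) by (auto simp: morphism_def closed_subvariety_def)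
qed

section \<open>Morphisms to the multiplicative group\<close>

lemma pts_Gm [simp]: "pts Gm = - {0}"
  by (simp add: Gm_def)

lemma generator_Gm: "(\<lambda>t\<in>- {0}. t) \<in> reg Gm" "(\<lambda>t\<in>- {0}. inverse t) \<in> reg Gm"
  unfolding Gm_def by (auto intro: generated_algebra.gen)

text \<open>Morphisms to the multiplicative group are the units of the coordinate algebra; hence they are
  closed under products and integer powers.\<close>

lemma morphism_GmI:
  assumes "function_algebra V" and "\<And>v. v \<in> pts V \<Longrightarrow> u v \<noteq> 0"
    and "(\<lambda>v\<in>pts V. u v) \<in> reg V" and "(\<lambda>v\<in>pts V. inverse (u v)) \<in> reg V"
  shows "morphism V Gm u"
proof (rule morphism_generatedI)
  show "reg Gm = generated_algebra (pts Gm) {\<lambda>t. t, \<lambda>t. inverse t}"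
    by (simp add: Gm_def)
qed (use assms in auto)

lemma morphism_GmD:
  assumes "morphism V Gm u"
  shows "\<And>v. v \<in> pts V \<Longrightarrow> u v \<noteq> 0"
    and "(\<lambda>v\<in>pts V. u v) \<in> reg V" and "(\<lambda>v\<in>pts V. inverse (u v)) \<in> reg V"
proof -
  show nz: "u v \<noteq> 0" if "v \<in> pts V" for v
    using morphism_maps[OF assms that] by simp
  have "(\<lambda>v\<in>pts V. (\<lambda>t\<in>- {0}. t) (u v)) = (\<lambda>v\<in>pts V. u v)"
    "(\<lambda>v\<in>pts V. (\<lambda>t\<in>- {0}. inverse t) (u v)) = (\<lambda>v\<in>pts V. inverse (u v))"
    using nz by (auto simp: fun_eq_iff restrict_def)
  then show "(\<lambda>v\<in>pts V. u v) \<in> reg V" "(\<lambda>v\<in>pts V. inverse (u v)) \<in> reg V"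
    using morphism_pullback[OF assms generator_Gm(1)] morphism_pullback[OF assms generator_Gm(2)]
    by simp_all
qed

lemma morphism_Gm_id: "morphism Gm Gm (\<lambda>t. t)"
  using generator_Gm by (intro morphism_GmI) auto

lemma morphism_Gm_inverse:
  assumes "function_algebra V" and "morphism V Gm u"
  shows "morphism V Gm (\<lambda>v. inverse (u v))"
  using morphism_GmD[OF assms(2)] by (intro morphism_GmI assms) auto

lemma morphism_Gm_mult:
  assumes V: "function_algebra V" and "morphism V Gm u" and "morphism V Gm w"
  shows "morphism V Gm (\<lambda>v. u v * w v)"
proof (rule morphism_GmI[OF V])
  have mult: "(\<lambda>v\<in>pts V. (\<lambda>v\<in>pts V. a v) v * (\<lambda>v\<in>pts V. b v) v) \<in> reg V"
    if "(\<lambda>v\<in>pts V. a v) \<in> reg V" "(\<lambda>v\<in>pts V. b v) \<in> reg V" for a b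
    using V that unfolding function_algebra_def by blast
  have restr: "(\<lambda>v\<in>pts V. (\<lambda>v\<in>pts V. a v) v * (\<lambda>v\<in>pts V. b v) v) = (\<lambda>v\<in>pts V. a v * b v)" for a b :: "_ \<Rightarrow> complex"
    by (auto simp: fun_eq_iff restrict_def)
  note D = morphism_GmD[OF assms(2)] morphism_GmD[OF assms(3)]
  show "u v * w v \<noteq> 0" if "v \<in> pts V" for v
    using D that by simp
  show "(\<lambda>v\<in>pts V. u v * w v) \<in> reg V"
    using mult[OF D(2,5)] by (simp only: restr)
  show "(\<lambda>v\<in>pts V. inverse (u v * w v)) \<in> reg V"
    using mult[OF D(3,6)] by (simp only: restr inverse_mult_distrib)
qed

lemma morphism_Gm_one:
  assumes "function_algebra V"
  shows "morphism V Gm (\<lambda>v. 1)"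
  using assms by (intro morphism_GmI) (auto simp: function_algebra_def)

lemma morphism_Gm_power:
  assumes "function_algebra V" and "morphism V Gm u"
  shows "morphism V Gm (\<lambda>v. u v ^ n)"
  by (induction n) (auto intro: morphism_Gm_one morphism_Gm_mult assms)

lemma morphism_Gm_power_int:
  assumes "function_algebra V" and "morphism V Gm u"
  shows "morphism V Gm (\<lambda>v. u v powi k)"
  by (cases "k \<ge> 0")
    (simp_all add: power_int_def morphism_Gm_power morphism_Gm_inverse assms)

text \<open>Both coordinate algebras are the Laurent polynomials: one is generated by the polynomials and
  the inverse of the coordinate, the other by the coordinate and its inverse.\<close>

lemma A1_star_eq_Gm: "A1_star = Gm"
proof -
  let ?P = "{x::complex. x \<noteq> 0}"
  let ?R = "generated_algebra ?P {\<lambda>t. t, inverse}"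
  let ?S = "generated_algebra ?P (generated_algebra UNIV {\<lambda>z. z} \<union> {inverse})"
  have poly: "restrict g ?P \<in> ?R" if "g \<in> generated_algebra UNIV {\<lambda>z. z}" for g
    using that
  proof induction
    case (gen f)
    then have "f \<in> {\<lambda>t. t, inverse}" by simp
    moreover have "restrict (restrict f UNIV) ?P = restrict f ?P" by (auto simp: fun_eq_iff)
    ultimately show ?case by (simp only: generated_algebra.gen)
  next
    case (const c)
    have "restrict (\<lambda>x\<in>UNIV. c) ?P = (\<lambda>x\<in>?P. c)"
      by (auto simp: fun_eq_iff restrict_def)
    then show ?case by (simp only: generated_algebra.const)
  next
    case (add f g)
    have "restrict (\<lambda>x\<in>UNIV. f x + g x) ?P = (\<lambda>x\<in>?P. restrict f ?P x + restrict g ?P x)"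
      by (auto simp: fun_eq_iff restrict_def)
    then show ?case using generated_algebra.add[OF add.IH] by (simp only:)
  next
    case (mult f g)
    have "restrict (\<lambda>x\<in>UNIV. f x * g x) ?P = (\<lambda>x\<in>?P. restrict f ?P x * restrict g ?P x)"
      by (auto simp: fun_eq_iff restrict_def)
    then show ?case using generated_algebra.mult[OF mult.IH] by (simp only:)
  qed
  have inv: "restrict inverse ?P \<in> ?R"
    by (rule generated_algebra.gen) simp
  have "(\<lambda>z::complex. z) \<in> generated_algebra UNIV {\<lambda>z. z}"
    using generated_algebra.gen[of "\<lambda>z. z" "{\<lambda>z. z}" UNIV] unfolding restrict_UNIV by blast
  then have id: "restrict (\<lambda>z. z) ?P \<in> ?S"
    by (intro generated_algebra.gen) simp
  have "?S \<subseteq> ?R"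
    using poly inv by (intro generated_algebra_subset) blast
  moreover have "?R \<subseteq> ?S"
    using id by (intro generated_algebra_subset) (blast intro: generated_algebra.gen)
  ultimately have "?S = ?R" by blast
  moreover have "?P = - {0}" by auto
  ultimately show ?thesis
    by (simp add: A1_star_def principal_open_def A1_def Gm_def)
qed

section \<open>Families of level sets over a parameter variety\<close>

text \<open>In this generality the one- and two-dimensional tori of parameters are treated alike: the
  product of such a family with another variety is a family of the same kind.\<close>

definition level_family ::
    "'a variety \<Rightarrow> ('a \<Rightarrow> complex) \<Rightarrow> 'b variety \<Rightarrow> ('b \<Rightarrow> complex) \<Rightarrow> ('a \<times> 'b) variety" where
  "level_family X f T \<chi> = closed_subvariety (X \<times>\<^sub>v T) {(x, t) \<in> pts (X \<times>\<^sub>v T). \<chi> t * f x = 1}"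

lemma X_tilde_eq_level_family: "X_tilde X f l = level_family X f Gm (\<lambda>t. t ^ l)"
  by (simp add: X_tilde_def level_family_def)

lemma pts_level_family:
  "pts (level_family X f T \<chi>) = {(x, t). x \<in> pts X \<and> t \<in> pts T \<and> \<chi> t * f x = 1}"
  by (auto simp: level_family_def)

lemma function_algebra_level_family [simp]: "function_algebra (level_family X f T \<chi>)"
  unfolding level_family_def by (rule function_algebra_closed_subvariety) auto

lemma morphism_level_family_fst: "morphism (level_family X f T \<chi>) X fst"
  and morphism_level_family_snd: "morphism (level_family X f T \<chi>) T snd"
proof -
  have "morphism (level_family X f T \<chi>) (X \<times>\<^sub>v T) (\<lambda>p. p)"
    unfolding level_family_def by (rule morphism_inclusion) auto
  from morphism_comp[OF this morphism_fst] morphism_comp[OF this morphism_snd]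
  show "morphism (level_family X f T \<chi>) X fst" "morphism (level_family X f T \<chi>) T snd"
    by simp_all
qed

lemma morphism_into_level_family:
  assumes "function_algebra V" and "morphism V X \<xi>" and "morphism V T \<tau>"
    and "\<And>v. v \<in> pts V \<Longrightarrow> \<chi> (\<tau> v) * f (\<xi> v) = 1"
  shows "morphism V (level_family X f T \<chi>) (\<lambda>v. (\<xi> v, \<tau> v))"
  unfolding level_family_def
proof (rule morphism_into_closed_subvariety)
  show "morphism V (X \<times>\<^sub>v T) (\<lambda>v. (\<xi> v, \<tau> v))"
    by (rule morphism_Pair[OF assms(1-3)])
qed (use assms(4) morphism_maps[OF assms(2)] morphism_maps[OF assms(3)] in auto)

text \<open>Moving \<open>x\<close> by \<open>a t\<close> scales \<open>f x\<close> by \<open>a t powi m\<close>. The hypothesis on \<open>\<chi>\<close> says that this factor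
  makes up exactly for the change of character from \<open>\<chi>\<close> to \<open>\<chi>' \<circ> \<theta>\<close>.\<close>

lemma twist_morphism:
  assumes act: "Gm_action X \<mu>" and semi: "semi_invariant X \<mu> f m"
    and \<theta>: "morphism T T' \<theta>" and a: "morphism T Gm a"
    and \<chi>: "\<And>t. t \<in> pts T \<Longrightarrow> \<chi>' (\<theta> t) * a t powi m = \<chi> t"
  shows "morphism (level_family X f T \<chi>) (level_family X f T' \<chi>')
           (\<lambda>p. (\<mu> (a (snd p), fst p), \<theta> (snd p)))"
proof (rule morphism_into_level_family)
  let ?V = "level_family X f T \<chi>"
  have "morphism ?V (Gm \<times>\<^sub>v X) (\<lambda>p. (a (snd p), fst p))"
    by (intro morphism_Pair morphism_comp[OF morphism_level_family_snd a] morphism_level_family_fst)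
      simp
  then show "morphism ?V X (\<lambda>p. \<mu> (a (snd p), fst p))"
    using act unfolding Gm_action_def by (elim conjE) (rule morphism_comp)
  show "morphism ?V T' (\<lambda>p. \<theta> (snd p))"
    by (rule morphism_comp[OF morphism_level_family_snd \<theta>])
  show "\<chi>' (\<theta> (snd p)) * f (\<mu> (a (snd p), fst p)) = 1" if p_in: "p \<in> pts ?V" for p
  proof -
    obtain x t where p: "p = (x, t)" "x \<in> pts X" "t \<in> pts T" "\<chi> t * f x = 1"
      using p_in by (auto simp: pts_level_family)
    have "f (\<mu> (a t, x)) = a t powi m * f x"
      using semi morphism_maps[OF a p(3)] p(2) unfolding semi_invariant_def by blast
    then show ?thesis using \<chi>[OF p(3)] p by (simp flip: mult.assoc)
  qed
qed simp

text \<open>The inverse is a twist as well, along \<open>\<eta>\<close> and by \<open>inverse (a (\<eta> t))\<close>, because the inverse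
  group element undoes the motion of \<open>x\<close>.\<close>

lemma twist_isomorphism:
  assumes act: "Gm_action X \<mu>" and semi: "semi_invariant X \<mu> f m"
    and T': "function_algebra T'"
    and \<theta>: "morphism T T' \<theta>" and \<eta>: "morphism T' T \<eta>"
    and inv: "\<And>t. t \<in> pts T \<Longrightarrow> \<eta> (\<theta> t) = t" "\<And>t. t \<in> pts T' \<Longrightarrow> \<theta> (\<eta> t) = t"
    and a: "morphism T Gm a"
    and \<chi>: "\<And>t. t \<in> pts T \<Longrightarrow> \<chi>' (\<theta> t) * a t powi m = \<chi> t"
  shows "isomorphism (level_family X f T \<chi>) (level_family X f T' \<chi>')
           (\<lambda>p. (\<mu> (a (snd p), fst p), \<theta> (snd p)))"
proof -
  let ?b = "\<lambda>t. inverse (a (\<eta> t))"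
  have b: "morphism T' Gm ?b"
    by (rule morphism_Gm_inverse[OF T' morphism_comp[OF \<eta> a]])
  have \<chi>': "\<chi> (\<eta> t) * ?b t powi m = \<chi>' t" if t: "t \<in> pts T'" for t
  proof -
    have "a (\<eta> t) powi m * ?b t powi m = 1"
      using morphism_maps[OF a morphism_maps[OF \<eta> t]] by (simp flip: power_int_mult_distrib)
    then show ?thesis
      using \<chi>[OF morphism_maps[OF \<eta> t]] inv(2)[OF t] by (metis mult.assoc mult.right_neutral)
  qed
  have unit: "\<mu> (1, x) = x" if "x \<in> pts X" for x
    using act that unfolding Gm_action_def by blast
  have comp: "\<mu> (s, \<mu> (t, x)) = \<mu> (s * t, x)" if "s \<noteq> 0" "t \<noteq> 0" "x \<in> pts X" for s t x
    using act that unfolding Gm_action_def by simp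
  show ?thesis
  proof (rule isomorphismI)
    show "morphism (level_family X f T \<chi>) (level_family X f T' \<chi>')
        (\<lambda>p. (\<mu> (a (snd p), fst p), \<theta> (snd p)))"
      by (rule twist_morphism[OF act semi \<theta> a \<chi>])
    show "morphism (level_family X f T' \<chi>') (level_family X f T \<chi>)
        (\<lambda>p. (\<mu> (?b (snd p), fst p), \<eta> (snd p)))"
      by (rule twist_morphism[OF act semi \<eta> b \<chi>'])
  qed (use unit comp inv morphism_GmD(1)[OF a] morphism_maps[OF \<eta>]
      in \<open>auto simp: pts_level_family\<close>)
qed

lemma level_family_times_isomorphic:
  fixes X :: "'a variety"
  shows "isomorphic (level_family X f T \<chi> \<times>\<^sub>v S) (level_family X f (T \<times>\<^sub>v S) (\<lambda>p. \<chi> (fst p)))"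
proof -
  let ?V = "level_family X f T \<chi> \<times>\<^sub>v S"
  let ?W = "level_family X f (T \<times>\<^sub>v S) (\<lambda>p. \<chi> (fst p))"
  have "morphism ?V ?W (\<lambda>p. (fst (fst p), (snd (fst p), snd p)))"
    by (intro morphism_into_level_family morphism_Pair morphism_snd
        morphism_comp[OF morphism_fst morphism_level_family_fst]
        morphism_comp[OF morphism_fst morphism_level_family_snd])
      (auto simp: pts_level_family)
  moreover have "morphism ?W ?V (\<lambda>p. ((fst p, fst (snd p)), snd (snd p)))"
    by (intro morphism_into_level_family morphism_Pair morphism_level_family_fst
        morphism_comp[OF morphism_level_family_snd morphism_fst]
        morphism_comp[OF morphism_level_family_snd morphism_snd])
      (auto simp: pts_level_family)
  ultimately have "isomorphism ?V ?W (\<lambda>p. (fst (fst p), (snd (fst p), snd p)))"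
    by (rule isomorphismI) auto
  then show ?thesis unfolding isomorphic_def by blast
qed

section \<open>Monomial automorphisms of the two-dimensional torus\<close>

definition monomial_map :: "int \<Rightarrow> int \<Rightarrow> int \<Rightarrow> int \<Rightarrow> complex \<times> complex \<Rightarrow> complex \<times> complex" where
  "monomial_map c d e h = (\<lambda>(t, s). (t powi c * s powi d, t powi e * s powi h))"

lemma morphism_monomial:
  "morphism (Gm \<times>\<^sub>v Gm) Gm (\<lambda>p. fst p powi a * snd p powi b)"
  by (intro morphism_Gm_mult morphism_Gm_power_int morphism_fst morphism_snd) auto

lemma morphism_monomial_map: "morphism (Gm \<times>\<^sub>v Gm) (Gm \<times>\<^sub>v Gm) (monomial_map c d e h)"
  unfolding monomial_map_def case_prod_unfold
  by (intro morphism_Pair morphism_monomial) simp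

lemma monomial_map_inverse:
  assumes "c * h - d * e = 1" and "p \<in> pts (Gm \<times>\<^sub>v Gm)"
  shows "monomial_map h (- d) (- e) c (monomial_map c d e h p) = p"
proof -
  obtain t s where p: "p = (t, s)" "t \<noteq> 0" "s \<noteq> 0"
    using assms(2) by auto
  have eq: "(t powi i * s powi j) powi k * (t powi i' * s powi j') powi k' =
      t powi (i * k + i' * k') * s powi (j * k + j' * k')" for i j k i' j' k'
    using p by (simp add: power_int_mult_distrib power_int_mult power_int_add)
  have weights: "c * h + e * - d = 1" "d * h + h * - d = 0" "c * - e + e * c = 0" "d * - e + h * c = 1"
    using assms(1) by (simp_all add: algebra_simps)
  show ?thesis
    unfolding monomial_map_def p(1) prod.case eq weights by simp
qed

text \<open>The rows \<open>(c, d)\<close> and \<open>(e, h)\<close> give the monomial automorphism of the torus, and \<open>(a, b)\<close> are the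
  exponents of the monomial by which points are moved. After division by the common gcd both weights
  are units modulo \<open>M\<close>, so their quotient \<open>c\<close> is a unit too, and a row \<open>(c, M)\<close> with coprime
  entries completes to a matrix of determinant one.\<close>

lemma unimodular_weights:
  fixes l l' m :: int
  assumes gcd: "gcd l m = gcd l' m" and m: "m \<noteq> 0"
  obtains a b c d e h :: int
  where "c * l' + a * m = l" and "d * l' + b * m = 0" and "c * h - d * e = 1"
proof -
  define g where "g = gcd l m"
  have g: "g \<noteq> 0" using m by (simp add: g_def)
  define L L' M where "L = l div g" and "L' = l' div g" and "M = m div g"
  have eqs: "l = g * L" "l' = g * L'" "m = g * M"
    using gcd_dvd1[of l m] gcd_dvd2[of l m] gcd_dvd1[of l' m] gcd
    unfolding L_def L'_def M_def g_def by (metis dvd_mult_div_cancel)+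
  have L: "coprime L M" unfolding L_def M_def g_def
    using m by (intro div_gcd_coprime) auto
  have L': "coprime L' M" unfolding L'_def M_def g_def gcd
    using m by (intro div_gcd_coprime) auto
  obtain u where "[L' * u = 1] (mod M)"
    using cong_solve_coprime_int[OF L'] by blast
  then obtain k where k: "L' * u = 1 + M * k"
    by (metis cong_iff_lin cong_sym)
  have "coprime u M"
    using \<open>[L' * u = 1] (mod M)\<close> coprime_iff_invertible_int[of u M] by (auto simp: mult.commute)
  then have "coprime (L * u) M" using L by simp
  then obtain h e where "(L * u) * h + M * e = 1"
    by (metis bezout_int coprime_iff_gcd_eq_1 mult.commute)
  moreover have "(L * u) * l' + (- L * k) * m = l"
  proof -
    have "(L * u) * l' = g * L * (L' * u)" by (simp add: eqs)
    also have "\<dots> = g * L * (1 + M * k)" by (simp only: k)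
    finally show ?thesis by (simp add: eqs algebra_simps)
  qed
  moreover have "M * l' + (- L') * m = 0" by (simp add: eqs)
  ultimately show ?thesis using that[of "L * u" "- L * k" M "- L'" h "- e"] by simp
qed

section \<open>The two isomorphisms\<close>

theorem proposition2:
  fixes X :: "'a variety" and \<mu> :: "complex \<times> 'a \<Rightarrow> 'a" and f :: "'a \<Rightarrow> complex"
    and m :: int and l l' :: nat
  assumes "affine_variety X"
    and "Gm_action X \<mu>" and "effective X \<mu>"
    and "semi_invariant X \<mu> f m" and "m \<noteq> 0"
    and "l \<ge> 1" and "l' \<ge> 1"
  shows "([int l' = int l] (mod m) \<or> [int l' = - int l] (mod m) \<longrightarrow>
           (\<exists>\<Phi> \<phi>. isomorphism (X_tilde X f l) (X_tilde X f l') \<Phi> \<and> automorphism Gm \<phi> \<and>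
              (\<forall>p\<in>pts (X_tilde X f l). rho X f l' (\<Phi> p) = \<phi> (rho X f l p)))) \<and>
         (gcd (int l) m = gcd (int l') m \<longrightarrow>
           isomorphic (X_tilde X f l \<times>\<^sub>v A1_star) (X_tilde X f l' \<times>\<^sub>v A1_star))"
proof (intro conjI impI)
  note act = assms(2) and semi = assms(4)
  assume "[int l' = int l] (mod m) \<or> [int l' = - int l] (mod m)"
  then obtain \<epsilon> k :: int where \<epsilon>: "\<epsilon> = 1 \<or> \<epsilon> = - 1" and k: "\<epsilon> * int l' + k * m = int l"
  proof
    assume "[int l' = int l] (mod m)"
    then obtain k where "int l = int l' + m * k" by (auto simp: cong_iff_lin)
    then show ?thesis using that[of 1 k] by (simp add: mult.commute)
  next
    assume "[int l' = - int l] (mod m)"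
    then obtain k where "- int l = int l' + m * k" by (auto simp: cong_iff_lin)
    then show ?thesis using that[of "- 1" "- k"] by (simp add: algebra_simps)
  qed
  \<comment> \<open>The sign \<open>\<epsilon>\<close> covers both congruences: the base changes by the identity or by inversion.\<close>
  let ?\<phi> = "\<lambda>t::complex. t powi \<epsilon>"
  let ?\<Phi> = "\<lambda>p. (\<mu> (snd p powi k, fst p), ?\<phi> (snd p))"
  have mono: "morphism Gm Gm (\<lambda>t. t powi j)" for j
    by (intro morphism_Gm_power_int morphism_Gm_id) simp
  have invol: "?\<phi> (?\<phi> t) = t" for t
    using \<epsilon> by (auto simp: power_int_minus)
  have "(t powi \<epsilon>) ^ l' * (t powi k) powi m = t ^ l" if "t \<in> pts Gm" for t
  proof -
    have "(t powi \<epsilon>) ^ l' * (t powi k) powi m = t powi (\<epsilon> * int l' + k * m)"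
      using that by (simp add: power_int_add power_int_mult)
    then show ?thesis by (simp add: k)
  qed
  then have iso: "isomorphism (X_tilde X f l) (X_tilde X f l') ?\<Phi>"
    unfolding X_tilde_eq_level_family
    by (intro twist_isomorphism[OF act semi function_algebra_Gm mono mono invol invol mono])
  moreover have "automorphism Gm ?\<phi>"
    by (rule isomorphismI[OF mono mono invol invol])
  moreover have "rho X f l' (?\<Phi> p) = ?\<phi> (rho X f l p)" if "p \<in> pts (X_tilde X f l)" for p
  proof -
    have "?\<Phi> p \<in> pts (X_tilde X f l')"
      using iso by (intro morphism_maps[OF _ that]) (simp only: isomorphism_def)
    then show ?thesis using that by (simp add: rho_def)
  qed
  ultimately show "\<exists>\<Phi> \<phi>. isomorphism (X_tilde X f l) (X_tilde X f l') \<Phi> \<and> automorphism Gm \<phi> \<and>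
      (\<forall>p\<in>pts (X_tilde X f l). rho X f l' (\<Phi> p) = \<phi> (rho X f l p))"
    by blast
next
  note act = assms(2) and semi = assms(4)
  assume same_gcd: "gcd (int l) m = gcd (int l') m"
  obtain a b c d e h where w: "c * int l' + a * m = int l" "d * int l' + b * m = 0"
      "c * h - d * e = 1"
    by (rule unimodular_weights[OF same_gcd assms(5)])
  let ?T = "Gm \<times>\<^sub>v Gm" and ?\<theta> = "monomial_map c d e h" and ?\<eta> = "monomial_map h (- d) (- e) c"
  let ?a = "\<lambda>p::complex \<times> complex. fst p powi a * snd p powi b"
  have inv: "?\<eta> (?\<theta> p) = p" "?\<theta> (?\<eta> p) = p" if "p \<in> pts ?T" for p
    using monomial_map_inverse[OF w(3) that]
      monomial_map_inverse[of h c "- d" "- e" p] w(3) that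
    by (simp_all add: mult.commute)
  have weight: "fst (?\<theta> p) ^ l' * ?a p powi m = fst p ^ l" if p_in: "p \<in> pts ?T" for p
  proof -
    obtain t s where p: "p = (t, s)" "t \<noteq> 0" "s \<noteq> 0" using p_in by auto
    have "fst (?\<theta> p) ^ l' * ?a p powi m =
        t powi (c * int l' + a * m) * s powi (d * int l' + b * m)"
      using p by (simp add: monomial_map_def power_int_add power_int_mult power_mult_distrib
          power_int_mult_distrib)
    then show ?thesis by (simp add: w p(1))
  qed
  have "isomorphic (level_family X f ?T (\<lambda>p. fst p ^ l)) (level_family X f ?T (\<lambda>p. fst p ^ l'))"
    unfolding isomorphic_def
    by (rule exI, rule twist_isomorphism[OF act semi function_algebra_prod morphism_monomial_map
          morphism_monomial_map inv morphism_monomial weight])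
  then show "isomorphic (X_tilde X f l \<times>\<^sub>v A1_star) (X_tilde X f l' \<times>\<^sub>v A1_star)"
    unfolding A1_star_eq_Gm X_tilde_eq_level_family
    by (rule isomorphic_trans[OF isomorphic_trans[OF level_family_times_isomorphic]
          isomorphic_sym[OF level_family_times_isomorphic]])
qed

end
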